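(* (i) For $0 < x < 1$, \begin{align*} \sum_{n=1}^\infty \frac{H_{n}^{(2)}}{n^{2}}x^{n} &=-Li_{4}(x)-2 Li_{4}\Big(\frac{-x}{1-x}\Big)+2 Li_{4}(1-x)-2 Li_{4}(1)+2 Li_{3}(x)\log(1-x)-2 Li_{3}(1)\log(1-x)\\ &\quad +\frac{1}{2}Li_{2}(x)^{2}-\frac{1}{6}\pi^{2}\log^{2}(1-x)+\frac{1}{3}\log(x)\log^{3}(1-x)-\frac{1}{12}\log^{4}(1-x). \end{align*} (ii) For $0 < x \le 1$, \begin{align*} \sum_{n=1}^\infty \frac{H_{n}^{(2)}}{n^{2}}(-x)^{n} &=-Li_{4}(-x)-2 Li_{4}\Big(\frac{x}{1+x}\Big)-2 Li_{4}\Big(\frac{1}{1+x}\Big)+2 Li_{4}(1)-2 Li_{3}\Big(\frac{x}{1+x}\Big)\log(1+x)\\ &\quad -2 Li_{3}\Big(\frac{1}{1+x}\Big)\log(1+x)+\frac{1}{2}Li_{2}(-x)^{2}-\frac{1}{6}\pi^{2}\log^{2}(1+x)-\frac{2}{3}\log(x)\log^{3}(1+x)+\frac{1}{2}\log^{4}(1+x). \end{align*}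
   Context: $H_n^{(2)}=\sum_{j=1}^n 1/j^2$. $\log$ is the natural logarithm. For $p\in\mathbb{N}$, the polylogarithm $Li_p$ on real arguments $y\le 1$ is defined by $Li_1(y)=-\log(1-y)$ for $y<1$ and $Li_p(y)=\int_0^y Li_{p-1}(t)/t\,\mathrm{d}t$ for $p\ge2$; for $|y|\le1$ this equals $\sum_{n\ge1}y^n/n^p$, and $Li_p(1)=\zeta(p)$ for $p\ge2$. (The argument $-x/(1-x)$ may be less than $-1$.) *)

theory Defs
  imports "HOL-Analysis.Analysis"
begin

definition harm2 :: "nat \<Rightarrow> real" where
  "harm2 n = (\<Sum>j=1..n. 1 / (real j)\<^sup>2)"

(* Meant for y <= 1 (y < 1 if p = 1).  The interval integral is oriented, so for y < 0 it is
   minus the integral over (y, 0); it runs over the open interval, so neither t = 0 nor, when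
   y = 1, the junk value of ln at 0 matters.  Order 0 is only there to make the function total. *)
fun Li :: "nat \<Rightarrow> real \<Rightarrow> real" where
  "Li 0 y = y / (1 - y)"
| "Li (Suc 0) y = - ln (1 - y)"
| "Li (Suc (Suc p)) y = (LBINT t=ereal 0..ereal y. Li (Suc p) t / t)"

end

theory Submission
  imports Defs "HOL-Real_Asymp.Real_Asymp"
begin

text \<open>
  Write $S(x)$ for the sum, $l = \log(1-x)$ and $u = -x/(1-x)$. The generating function
  $\sum H_n^{(2)} x^n = Li_2(x)/(1-x)$ makes $T(x) = x S'(x)$ a primitive of
  $Li_2(x)\,(1/x + 1/(1-x))$. Landen's identity $Li_2(u) = -Li_2(x) - l^2/2$ shows that
  $T(x) = -Li_3(x) - 2 Li_3(u) + l\,Li_2(x) + l^3/3$ on all of $(-1,1)$. It remains to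
  differentiate the claimed closed forms. The terms over $1/x$ give $T(x)/x$, and those over
  $1/(1 \mp x)$ cancel: in (i) by the relation between $Li_3(u)$, $Li_3(x)$ and $Li_3(1-x)$, in
  (ii) by Euler's reflection formula for $Li_2$. Both sides vanish as $x$ tends to $0$ from the
  right, and the value at $x = 1$ in (ii) follows by continuity.
\<close>

section \<open>Continuity and derivatives of the polylogarithms below 1\<close>

text \<open>The integrand of the next order, with its removable singularity at 0 filled in.\<close>
definition Li_quot :: "nat \<Rightarrow> real \<Rightarrow> real" where
  "Li_quot p t = (if t = 0 then 1 else Li p t / t)"

lemma Li_0 [simp]: "0 < p \<Longrightarrow> Li p 0 = 0"
  by (induction p "0::real" rule: Li.induct) (simp_all add: zero_ereal_def[symmetric])

text \<open>As \<open>Li p 0 = 0\<close>, the quotient \<open>Li p h / h\<close> is the difference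
  quotient of \<open>Li p\<close> at 0, so it tends to the derivative 1, which is the value filled
  in. Away from 0 this is a quotient of continuous functions.\<close>

lemma isCont_Li_quot:
  assumes "isCont (Li p) y" and "0 < p" and "(Li p has_real_derivative 1) (at 0)"
  shows "isCont (Li_quot p) y"
proof (cases "y = 0")
  case True
  have "((\<lambda>h. Li p h / h) \<longlongrightarrow> 1) (at 0)"
    using assms(2,3) by (simp add: DERIV_def)
  hence "(Li_quot p \<longlongrightarrow> 1) (at 0)"
    by (rule Lim_transform_eventually) (auto simp: Li_quot_def eventually_at_filter)
  thus ?thesis by (simp add: True isCont_def Li_quot_def)
next
  case False
  have "eventually (\<lambda>t. t \<noteq> 0) (nhds y)"
    by (rule t1_space_nhds) fact
  hence "eventually (\<lambda>t. Li_quot p t = Li p t / t) (nhds y)"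
    by eventually_elim (simp add: Li_quot_def)
  hence "isCont (Li_quot p) y \<longleftrightarrow> isCont (\<lambda>t. Li p t / t) y"
    by (rule isCont_cong)
  thus ?thesis using assms(1) False by (auto intro!: continuous_intros)
qed

lemma DERIV_Li_step:
  assumes "\<And>y. y < 1 \<Longrightarrow> isCont (Li_quot (Suc p)) y" and "y < 1"
  shows "(Li (Suc (Suc p)) has_real_derivative Li_quot (Suc p) y) (at y)"
proof -
  \<comment> \<open>The interval from \<open>a\<close> to \<open>b\<close> has both 0 and
    \<open>y\<close> in its interior and stays below 1, so the fundamental theorem gives a two-sided
    derivative at \<open>y\<close>.\<close>
  define a b where "a = min y 0 - 1" and "b = (max y 0 + 1) / 2"
  have ab: "a < y" "a < 0" "y < b" "0 < b" "b < 1"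
    using assms(2) by (auto simp: a_def b_def)
  \<comment> \<open>The integral runs over the open interval between 0 and \<open>u\<close>, which
    omits 0, so filling in the singularity does not change it.\<close>
  have "Li (Suc (Suc p)) = (\<lambda>u. LBINT t=ereal 0..ereal u. Li_quot (Suc p) t)"
    unfolding Li.simps
    by (intro ext interval_integral_cong) (auto simp: Li_quot_def einterval_def min_def max_def split: if_splits)
  moreover have "((\<lambda>u. LBINT t=ereal 0..ereal u. Li_quot (Suc p) t)
      has_vector_derivative Li_quot (Suc p) y) (at y within {a..b})"
    using ab assms(1)
    by (intro interval_integral_FTC2 continuous_at_imp_continuous_on) auto
  ultimately show ?thesis
    using ab at_within_Icc_at[of a y b]
    by (simp add: has_real_derivative_iff_has_vector_derivative)
qed

text \<open>The derivative at 0 is carried through the induction because it makes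
  \<open>Li_quot\<close> continuous there, and this continuity makes the next order
  differentiable.\<close>

lemma isCont_Li_and_DERIV_Li_0:
  "(\<forall>y<1. isCont (Li (Suc p)) y) \<and> (Li (Suc p) has_real_derivative 1) (at 0)"
proof (induction p)
  case 0
  have "Li (Suc 0) = (\<lambda>y. - ln (1 - y))" by auto
  thus ?case by (auto intro!: continuous_intros derivative_eq_intros)
next
  case (Suc p)
  hence "isCont (Li_quot (Suc p)) y" if "y < 1" for y
    using that by (auto intro: isCont_Li_quot)
  hence *: "(Li (Suc (Suc p)) has_real_derivative Li_quot (Suc p) y) (at y)" if "y < 1" for y
    using that by (intro DERIV_Li_step) auto
  have "(Li (Suc (Suc p)) has_real_derivative 1) (at 0)"
    using *[of 0] by (simp add: Li_quot_def del: Li.simps)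
  thus ?case using * DERIV_isCont by blast
qed

lemma isCont_Li: "0 < p \<Longrightarrow> y < 1 \<Longrightarrow> isCont (Li p) y"
  using isCont_Li_and_DERIV_Li_0[of "p - 1"] by simp

lemma DERIV_Li:
  assumes "0 < p" "y < 1"
  shows "(Li (Suc p) has_real_derivative Li_quot p y) (at y)"
proof -
  have "isCont (Li_quot p) z" if "z < 1" for z
    using assms(1) that isCont_Li_and_DERIV_Li_0[of "p - 1"] by (intro isCont_Li_quot) auto
  thus ?thesis using assms DERIV_Li_step[of "p - 1" y] by simp
qed

section \<open>Power series with bounded or absolutely summable coefficients\<close>

lemma continuous_on_suminf_power:
  fixes c :: "nat \<Rightarrow> real"
  assumes "summable (\<lambda>n. \<bar>c n\<bar>)"
  shows "continuous_on {-1..1} (\<lambda>x. \<Sum>n. c n * x ^ n)"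
proof -
  have "uniform_limit {-1..1} (\<lambda>N x. \<Sum>n<N. c n * x ^ n) (\<lambda>x. \<Sum>n. c n * x ^ n) sequentially"
    using assms
    by (intro Weierstrass_m_test[where M="\<lambda>n. \<bar>c n\<bar>"])
       (auto simp: abs_mult power_abs intro!: mult_left_le power_le_one)
  thus ?thesis
    by (rule uniform_limit_theorem[rotated]) (auto intro!: always_eventually continuous_intros)
qed

lemma summable_bounded_power:
  fixes c :: "nat \<Rightarrow> real"
  assumes "\<And>n. \<bar>c n\<bar> \<le> B" "\<bar>x\<bar> < 1"
  shows "summable (\<lambda>n. c n * x ^ n)"
proof (rule summable_comparison_test)
  show "\<exists>N. \<forall>n\<ge>N. norm (c n * x ^ n) \<le> B * \<bar>x\<bar> ^ n"
    using assms by (auto simp: abs_mult power_abs intro!: mult_right_mono)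
  show "summable (\<lambda>n. B * \<bar>x\<bar> ^ n)"
    using assms by (intro summable_mult summable_geometric) auto
qed

text \<open>The convention \<open>c / 0 = 0\<close> lets the bound cover \<open>n = 0\<close>, so
  series with coefficients \<open>c n / n\<close> can be indexed from 0.\<close>

lemma abs_div_nat_le:
  fixes c :: real
  assumes "\<bar>c\<bar> \<le> B"
  shows "\<bar>c / real n\<bar> \<le> B"
proof (cases "n = 0")
  case False
  hence "\<bar>c / real n\<bar> \<le> \<bar>c\<bar>"
    by (simp add: field_simps mult_le_cancel_left1)
  thus ?thesis using assms by linarith
qed (use assms in simp)

lemma DERIV_suminf_div_power:
  fixes c :: "nat \<Rightarrow> real"
  assumes "\<And>n. \<bar>c n\<bar> \<le> B" "\<bar>x\<bar> < 1"
  shows "((\<lambda>x. \<Sum>n. c n / real n * x ^ n) has_real_derivative (\<Sum>n. c (Suc n) * x ^ n)) (at x)"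
proof -
  have B: "\<bar>c n / real n\<bar> \<le> B" for n
    using assms(1) by (rule abs_div_nat_le)
  \<comment> \<open>Termwise differentiation at \<open>x\<close> requires convergence at some point
    \<open>K\<close> of larger modulus.\<close>
  obtain K where K: "\<bar>x\<bar> < K" "K < 1" using dense assms(2) by blast
  have "((\<lambda>x. \<Sum>n. c n / real n * x ^ n) has_real_derivative
      (\<Sum>n. diffs (\<lambda>n. c n / real n) n * x ^ n)) (at x)"
    using K by (intro termdiffs_strong[where K=K] summable_bounded_power[where B=B] B) auto
  thus ?thesis by (simp add: diffs_def)
qed

lemma suminf_power_split:
  fixes c :: "nat \<Rightarrow> real"
  assumes "\<And>n. \<bar>c n\<bar> \<le> B" "\<bar>x\<bar> < 1"
  shows "(\<Sum>n. c n * x ^ n) = c 0 + x * (\<Sum>n. c (Suc n) * x ^ n)"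
proof -
  have 1: "summable (\<lambda>n. c n * x ^ n)" by (rule summable_bounded_power) fact+
  have 2: "summable (\<lambda>n. c (Suc n) * x ^ n)"
    by (rule summable_bounded_power[where B=B]) (use assms in auto)
  show ?thesis
    using suminf_split_head[OF 1] suminf_mult[OF 2, of x] by (simp add: mult_ac)
qed

section \<open>Identities from equal derivatives\<close>

lemma eq_if_DERIV_eq:
  fixes f g :: "real \<Rightarrow> real"
  assumes "\<And>x. a < x \<Longrightarrow> x < b \<Longrightarrow> (f has_real_derivative h x) (at x)"
    and "\<And>x. a < x \<Longrightarrow> x < b \<Longrightarrow> (g has_real_derivative h x) (at x)"
    and "a < y" "y < b" "f y = g y" "a < x" "x < b"
  shows "f x = g x"
proof -
  have "((\<lambda>x. f x - g x) has_real_derivative 0) (at x within {a<..<b})" if "x \<in> {a<..<b}" for x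
    using DERIV_diff[OF assms(1,2)] that by (auto intro: has_field_derivative_at_within)
  then obtain c where "\<And>x. x \<in> {a<..<b} \<Longrightarrow> f x - g x = c"
    using has_field_derivative_zero_constant[of "{a<..<b}" "\<lambda>x. f x - g x"] by auto
  from this[of x] this[of y] show ?thesis using assms by auto
qed

text \<open>Here a common limit at the left endpoint replaces the common value at an inner point.
  This suits closed forms containing \<open>ln x\<close>, which are compared as \<open>x\<close>
  tends to 0 from the right.\<close>

lemma eq_if_DERIV_eq_at_right:
  fixes f g :: "real \<Rightarrow> real"
  assumes "\<And>x. a < x \<Longrightarrow> x < b \<Longrightarrow> (f has_real_derivative h x) (at x)"
    and "\<And>x. a < x \<Longrightarrow> x < b \<Longrightarrow> (g has_real_derivative h x) (at x)"
    and "(f \<longlongrightarrow> l) (at_right a)" "(g \<longlongrightarrow> l) (at_right a)" "a < x" "x < b"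
  shows "f x = g x"
proof -
  have eq: "f y - g y = f x - g x" if "a < y" "y < b" for y
  proof -
    have "f y = g y + (f x - g x)"
    proof (rule eq_if_DERIV_eq[where f=f and g="\<lambda>z. g z + (f x - g x)" and h=h
          and a=a and b=b and y=x])
      fix z assume "a < z" "z < b"
      thus "((\<lambda>z. g z + (f x - g x)) has_real_derivative h z) (at z)"
        using DERIV_add[OF assms(2) DERIV_const] by simp
    qed (use assms that in auto)
    thus ?thesis by simp
  qed
  have "((\<lambda>y. f y - g y) \<longlongrightarrow> 0) (at_right a)"
    using tendsto_diff[OF assms(3,4)] by simp
  moreover have "((\<lambda>y. f y - g y) \<longlongrightarrow> f x - g x) (at_right a)"
    using assms(5,6)
    by (intro tendsto_eventually eventually_at_rightI[of a b] eq) auto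
  ultimately have "0 = f x - g x" by (intro tendsto_unique[of "at_right a"]) simp_all
  thus ?thesis by simp
qed

section \<open>Power series of the polylogarithms and their values at 1\<close>

lemma abs_inverse_power_le_1: "\<bar>1 / real n ^ p\<bar> \<le> 1"
  by (cases "n = 0"; cases "p = 0") (auto simp: field_simps power_0_left)

text \<open>Both sides vanish at 0 and have the same derivative: the geometric series in order 1,
  and in higher orders \<open>Li_quot\<close> of the previous order, expanded by the induction
  hypothesis. The term \<open>n = 0\<close> is 0 because \<open>1 / 0 = 0\<close>.\<close>

lemma Li_eq_suminf:
  assumes "0 < p" "\<bar>y\<bar> < 1"
  shows "Li p y = (\<Sum>n. 1 / real n ^ p * y ^ n)"
  using assms
proof (induction p arbitrary: y)
  case (Suc p)
  define f where "f y = (\<Sum>n. 1 / real (Suc n) ^ p * y ^ n)" for y :: real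
  note bd = abs_inverse_power_le_1
  have D: "((\<lambda>x. \<Sum>n. 1 / real n ^ Suc p * x ^ n) has_real_derivative f y) (at y)" if "\<bar>y\<bar> < 1" for y
    using DERIV_suminf_div_power[of "\<lambda>n. 1 / real n ^ p" 1 y] bd that
    by (simp add: f_def mult.commute)
  have D': "(Li (Suc p) has_real_derivative f y) (at y)" if y: "\<bar>y\<bar> < 1" for y
  proof (cases "p = 0")
    case True
    have "Li (Suc p) = (\<lambda>y. - ln (1 - y))" using True by auto
    moreover have "f y = 1 / (1 - y)"
      using y by (simp add: f_def True suminf_geometric)
    ultimately show ?thesis using y by (auto intro!: derivative_eq_intros)
  next
    case False
    have "f y = Li_quot p y"
    proof (cases "y = 0")
      case True
      thus ?thesis
        using powser_zero[of "\<lambda>n. 1 / real (Suc n) ^ p"] by (simp only: f_def Li_quot_def) simp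
    next
      case y0: False
      have "(\<Sum>n. 1 / real n ^ p * y ^ n) = y * f y"
        using suminf_power_split[of "\<lambda>n. 1 / real n ^ p" 1 y] bd y False by (simp add: f_def)
      thus ?thesis using Suc.IH[of y] False y y0 by (simp add: Li_quot_def)
    qed
    thus ?thesis using DERIV_Li[of p y] False y by auto
  qed
  show ?case
    by (rule eq_if_DERIV_eq[where a="-1" and b=1 and y=0 and h=f and f="Li (Suc p)"
          and g="\<lambda>y. \<Sum>n. 1 / real n ^ Suc p * y ^ n"])
       (use Suc.prems D D' powser_zero[of "\<lambda>n. 1 / real n ^ Suc p"] in
         \<open>auto simp del: Li.simps power_Suc\<close>)
qed simp

lemma Li_nonneg: "0 < p \<Longrightarrow> 0 \<le> y \<Longrightarrow> y < 1 \<Longrightarrow> 0 \<le> Li p y"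
  using summable_bounded_power[OF abs_inverse_power_le_1[of _ p], of y]
  by (subst Li_eq_suminf) (auto intro!: suminf_nonneg)

lemma summable_inverse_power: "2 \<le> p \<Longrightarrow> summable (\<lambda>n. 1 / real n ^ p)"
  using inverse_power_summable[of p, where 'a=real] by (simp add: field_simps)

lemma Li_tendsto_at_left_1:
  assumes "2 \<le> p"
  shows "(Li p \<longlongrightarrow> (\<Sum>n. 1 / real n ^ p)) (at_left 1)"
proof -
  have "continuous_on {-1..1} (\<lambda>x. \<Sum>n. 1 / real n ^ p * x ^ n)"
    using summable_inverse_power[OF assms] by (intro continuous_on_suminf_power) simp
  from bspec[OF this[unfolded continuous_on_def], of 1]
  have "((\<lambda>x. \<Sum>n. 1 / real n ^ p * x ^ n) \<longlongrightarrow> (\<Sum>n. 1 / real n ^ p)) (at 1 within {-1..1})"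
    by simp
  hence "((\<lambda>x. \<Sum>n. 1 / real n ^ p * x ^ n) \<longlongrightarrow> (\<Sum>n. 1 / real n ^ p)) (at_left 1)"
    by (simp add: at_within_Icc_at_left)
  thus ?thesis
    by (rule Lim_transform_eventually)
       (use assms in \<open>auto intro!: eventually_at_leftI[of 0] simp: Li_eq_suminf\<close>)
qed

text \<open>The derivative of \<open>Li p\<close> is known only below 1, so the defining integral is
  treated as an improper one: its integrand is nonnegative, and \<open>Li p\<close> itself is a
  primitive whose limits at 0 and 1 are known.\<close>

lemma Li_1_eq_suminf:
  assumes "2 \<le> p"
  shows "Li p 1 = (\<Sum>n. 1 / real n ^ p)"
proof -
  obtain q where p: "p = Suc (Suc q)"
    using assms by (metis Suc_le_D numeral_2_eq_2 Suc_le_mono)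
  have "Li p 1 = (LBINT t=ereal 0..ereal 1. Li (Suc q) t / t)"
    by (simp add: p)
  also have "\<dots> = (\<Sum>n. 1 / real n ^ p) - 0"
  proof (rule interval_integral_FTC_nonneg(2)[where F="Li p"])
    fix x assume "ereal 0 < ereal x" "ereal x < ereal 1"
    thus "(Li p has_real_derivative Li (Suc q) x / x) (at x)"
         "isCont (\<lambda>t. Li (Suc q) t / t) x"
      using DERIV_Li[of "Suc q" x] isCont_Li[of "Suc q" x]
      by (auto simp: p Li_quot_def simp del: Li.simps intro!: continuous_intros)
  next
    have "isCont (Li p) 0" using assms by (intro isCont_Li) auto
    hence "(Li p \<longlongrightarrow> 0) (at_right 0)"
      using assms by (auto simp: isCont_def filterlim_at_split)
    thus "((Li p \<circ> real_of_ereal) \<longlongrightarrow> 0) (at_right (ereal 0))"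
      by (simp only: ereal_tendsto_simps)
    show "((Li p \<circ> real_of_ereal) \<longlongrightarrow> (\<Sum>n. 1 / real n ^ p)) (at_left (ereal 1))"
      using Li_tendsto_at_left_1[OF assms] by (simp only: ereal_tendsto_simps)
  qed (auto intro!: AE_I2 divide_nonneg_nonneg Li_nonneg simp del: Li.simps)
  finally show ?thesis by simp
qed

lemma Li_2_1: "Li 2 1 = pi\<^sup>2 / 6"
proof -
  have "(\<lambda>n. 1 / real (Suc n) ^ 2) sums (pi\<^sup>2 / 6)"
    using inverse_squares_sums by (simp add: add.commute)
  hence "(\<lambda>n. 1 / real n ^ 2) sums (pi\<^sup>2 / 6)"
    by (subst (asm) sums_Suc_iff) simp
  thus ?thesis by (simp add: Li_1_eq_suminf sums_iff)
qed

text \<open>Only the left-hand limit of \<open>Li p\<close> at 1 has been established, so the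
  argument must approach 1 from below.\<close>

lemma Li_tendsto_Li_1:
  assumes "2 \<le> p" "filterlim f (at_left 1) F"
  shows "((\<lambda>x. Li p (f x)) \<longlongrightarrow> Li p 1) F"
  using filterlim_compose[OF Li_tendsto_at_left_1[OF assms(1)] assms(2)]
  by (simp add: Li_1_eq_suminf[OF assms(1)])

lemma Li_one_minus_tendsto:
  assumes "2 \<le> p"
  shows "((\<lambda>x. Li p (1 - x)) \<longlongrightarrow> Li p 1) (at_right 0)"
proof (rule Li_tendsto_Li_1[OF assms])
  show "filterlim (\<lambda>x::real. 1 - x) (at_left 1) (at_right 0)"
    by real_asymp
qed

lemma tendsto_Li [tendsto_intros]:
  assumes "(f \<longlongrightarrow> y) F" "0 < p" "y < 1"
  shows "((\<lambda>x. Li p (f x)) \<longlongrightarrow> Li p y) F"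
  using isCont_tendsto_compose[OF isCont_Li assms(1)] assms by auto

section \<open>Functional equations of the dilogarithm\<close>

lemma DERIV_Li_chain:
  assumes "(f has_real_derivative f') (at x)" "f x < 1"
  shows "((\<lambda>x. Li 2 (f x)) has_real_derivative Li_quot 1 (f x) * f') (at x)"
    and "((\<lambda>x. Li 3 (f x)) has_real_derivative Li_quot 2 (f x) * f') (at x)"
    and "((\<lambda>x. Li 4 (f x)) has_real_derivative Li_quot 3 (f x) * f') (at x)"
  using DERIV_chain2[OF DERIV_Li assms(1), of 1] DERIV_chain2[OF DERIV_Li assms(1), of 2]
    DERIV_chain2[OF DERIV_Li assms(1), of 3] assms(2)
  by (simp_all add: numeral_eq_Suc del: Li.simps)

lemma Li_1_eq: "Li 1 y = - ln (1 - y)" by simp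

text \<open>Euler's reflection formula. The derivatives agree, and as \<open>x\<close> tends to 0
  both sides tend to \<open>Li 2 1\<close>, since \<open>ln x * ln (1 - x)\<close> vanishes in the
  limit.\<close>

lemma Li_2_reflection:
  assumes "0 < x" "x < 1"
  shows "Li 2 x + Li 2 (1 - x) = pi\<^sup>2 / 6 - ln x * ln (1 - x)"
proof (rule eq_if_DERIV_eq_at_right[where a=0 and b=1 and l="pi\<^sup>2 / 6" and x=x
      and f="\<lambda>x. Li 2 x + Li 2 (1 - x)" and g="\<lambda>x. pi\<^sup>2 / 6 - ln x * ln (1 - x)"
      and h="\<lambda>x. - ln (1 - x) / x + ln x / (1 - x)"])
  fix x :: real assume x: "0 < x" "x < 1"
  show "((\<lambda>x. Li 2 x + Li 2 (1 - x)) has_real_derivative - ln (1 - x) / x + ln x / (1 - x)) (at x)"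
    using x by (auto intro!: derivative_eq_intros DERIV_Li_chain
      simp: Li_quot_def Li_1_eq simp del: Li.simps One_nat_def)
  show "((\<lambda>x. pi\<^sup>2 / 6 - ln x * ln (1 - x)) has_real_derivative - ln (1 - x) / x + ln x / (1 - x)) (at x)"
    using x by (auto intro!: derivative_eq_intros)
next
  have "((\<lambda>x. Li 2 x) \<longlongrightarrow> Li 2 0) (at_right 0)" by (intro tendsto_intros) auto
  from tendsto_add[OF this Li_one_minus_tendsto[of 2]]
  show "((\<lambda>x. Li 2 x + Li 2 (1 - x)) \<longlongrightarrow> pi\<^sup>2 / 6) (at_right 0)"
    by (simp add: Li_2_1)
  have "((\<lambda>x::real. ln x * ln (1 - x)) \<longlongrightarrow> 0) (at_right 0)" by real_asymp
  from tendsto_diff[OF tendsto_const this]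
  show "((\<lambda>x. pi\<^sup>2 / 6 - ln x * ln (1 - x)) \<longlongrightarrow> pi\<^sup>2 / 6) (at_right 0)" by simp
qed (use assms in auto)

text \<open>Both sides vanish at 0 and have derivative \<open>ln (1 - x) / (x * (1 - x))\<close>,
  whose removable singularity at 0 is filled with the limit -1. The left endpoint
  \<open>min x 0 - 1\<close> keeps 0 and \<open>x\<close> in one interval. Negative \<open>x\<close>
  is included because the alternating sum uses the identity at \<open>- x\<close>.\<close>

lemma Li_2_Landen:
  assumes "x < 1"
  shows "Li 2 (- x / (1 - x)) = - Li 2 x - (ln (1 - x))\<^sup>2 / 2"
proof (rule eq_if_DERIV_eq[where a="min x 0 - 1" and b=1 and y=0 and x=x
      and f="\<lambda>x. Li 2 (- x / (1 - x))" and g="\<lambda>x. - Li 2 x - (ln (1 - x))\<^sup>2 / 2"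
      and h="\<lambda>x. if x = 0 then - 1 else ln (1 - x) / (x * (1 - x))"])
  fix x :: real assume x: "x < 1"
  have u: "- x / (1 - x) < 1" "- x / (1 - x) = 0 \<longleftrightarrow> x = 0" "1 - - x / (1 - x) = 1 / (1 - x)"
    using x by (auto simp: field_simps)
  have du: "((\<lambda>x. - x / (1 - x)) has_real_derivative - 1 / (1 - x)\<^sup>2) (at x)"
    using x by (auto intro!: derivative_eq_intros simp: field_simps power2_eq_square)
  have "Li_quot 1 (- x / (1 - x)) * (- 1 / (1 - x)\<^sup>2) =
      (if x = 0 then - 1 else ln (1 - x) / (x * (1 - x)))"
  proof (cases "x = 0")
    case False
    \<comment> \<open>Used with \<open>d = 1 - x\<close> and \<open>L = - ln (1 / d)\<close>, which
      equals \<open>ln d\<close>.\<close>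
    have "L / (- x / d) * (- 1 / d\<^sup>2) = L / (x * d)" if "d \<noteq> 0" for L d
      using False that by (simp add: field_simps power2_eq_square)
    thus ?thesis
      using x False unfolding Li_quot_def u(2) Li_1_eq u(3) by (simp add: ln_div)
  qed (simp add: Li_quot_def)
  from DERIV_Li_chain(1)[OF du u(1), unfolded this]
  show "((\<lambda>x. Li 2 (- x / (1 - x))) has_real_derivative
      (if x = 0 then - 1 else ln (1 - x) / (x * (1 - x)))) (at x)" .
  show "((\<lambda>x. - Li 2 x - (ln (1 - x))\<^sup>2 / 2) has_real_derivative
      (if x = 0 then - 1 else ln (1 - x) / (x * (1 - x)))) (at x)"
    using x by (auto intro!: derivative_eq_intros DERIV_Li_chain
      simp: Li_quot_def Li_1_eq field_simps simp del: Li.simps One_nat_def)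
qed (use assms in auto)

section \<open>Generating function of the second-order harmonic numbers\<close>

lemma harm2_0 [simp]: "harm2 0 = 0" and harm2_Suc: "harm2 (Suc n) = harm2 n + 1 / real (Suc n) ^ 2"
  by (simp_all add: harm2_def)

text \<open>These are partial sums of a convergent series of nonnegative terms, whose term at 0
  vanishes because \<open>1 / 0 = 0\<close>.\<close>

lemma abs_harm2_le: "\<bar>harm2 n\<bar> \<le> (\<Sum>n. 1 / real n ^ 2)"
proof -
  have "harm2 n = (\<Sum>j<Suc n. 1 / real j ^ 2)"
    by (induction n) (simp_all add: harm2_Suc)
  moreover have "\<dots> \<le> (\<Sum>n. 1 / real n ^ 2)"
    by (intro sum_le_suminf summable_inverse_power) auto
  moreover have "0 \<le> harm2 n" by (auto simp: harm2_def intro: sum_nonneg)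
  ultimately show ?thesis by simp
qed

lemma abs_harm2_div_le: "\<bar>harm2 n / real n\<bar> \<le> (\<Sum>n. 1 / real n ^ 2)"
  by (rule abs_div_nat_le[OF abs_harm2_le])

text \<open>Multiplication by \<open>1 - x\<close> turns the coefficients into the differences
  \<open>harm2 (Suc n) - harm2 n\<close>; the further factor \<open>x\<close> restores the exponents
  in the series of \<open>Li 2\<close>.\<close>

lemma suminf_harm2_power:
  assumes "\<bar>x\<bar> < 1"
  shows "x * (1 - x) * (\<Sum>n. harm2 (Suc n) * x ^ n) = Li 2 x"
proof -
  have s: "summable (\<lambda>n. harm2 n * x ^ n)" "summable (\<lambda>n. harm2 (Suc n) * x ^ n)"
    using assms by (auto intro!: summable_bounded_power abs_harm2_le)
  have "(1 - x) * (\<Sum>n. harm2 (Suc n) * x ^ n)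
      = (\<Sum>n. harm2 (Suc n) * x ^ n) - (\<Sum>n. harm2 n * x ^ n)"
    using suminf_power_split[OF abs_harm2_le assms] by (simp add: algebra_simps)
  also have "\<dots> = (\<Sum>n. 1 / real (Suc n) ^ 2 * x ^ n)"
    by (subst suminf_diff[OF s(2,1)]) (simp add: harm2_Suc algebra_simps)
  finally have "x * ((1 - x) * (\<Sum>n. harm2 (Suc n) * x ^ n)) = (\<Sum>n. 1 / real n ^ 2 * x ^ n)"
    using suminf_power_split[OF abs_inverse_power_le_1[of _ 2] assms] by simp
  thus ?thesis using Li_eq_suminf[of 2 x] assms by (simp add: mult.assoc)
qed

section \<open>Derivatives of the building blocks and the first integration\<close>

text \<open>For \<open>u = - x / (1 - x)\<close> the logarithmic derivative is
  \<open>1 / x + 1 / (1 - x)\<close>. At \<open>x = 0\<close>, where \<open>u\<close> vanishes, the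
  value -1 is the derivative of \<open>u\<close> times \<open>Li_quot p 0 = 1\<close>.\<close>

lemma DERIV_Li_neg_div_one_minus:
  assumes "x < 1"
  shows "((\<lambda>x. Li 3 (- x / (1 - x))) has_real_derivative
      (if x = 0 then - 1 else Li 2 (- x / (1 - x)) * (1 / x + 1 / (1 - x)))) (at x)"
    and "((\<lambda>x. Li 4 (- x / (1 - x))) has_real_derivative
      (if x = 0 then - 1 else Li 3 (- x / (1 - x)) * (1 / x + 1 / (1 - x)))) (at x)"
proof -
  have u: "- x / (1 - x) < 1" "- x / (1 - x) = 0 \<longleftrightarrow> x = 0"
    using assms by (auto simp: field_simps)
  have du: "((\<lambda>x. - x / (1 - x)) has_real_derivative - 1 / (1 - x)\<^sup>2) (at x)"
    using assms by (auto intro!: derivative_eq_intros simp: field_simps power2_eq_square)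
  have "Li_quot p (- x / (1 - x)) * (- 1 / (1 - x)\<^sup>2) =
      (if x = 0 then - 1 else Li p (- x / (1 - x)) * (1 / x + 1 / (1 - x)))" for p
  proof (cases "x = 0")
    case False
    have "- 1 / (1 - x)\<^sup>2 / (- x / (1 - x)) = 1 / x + 1 / (1 - x)"
      using False assms by (simp add: divide_simps power2_eq_square)
    thus ?thesis
      using False unfolding Li_quot_def u(2)
      by (simp only: if_False times_divide_eq_left) (metis times_divide_eq_right)
  qed (simp add: Li_quot_def)
  note * = this
  show "((\<lambda>x. Li 3 (- x / (1 - x))) has_real_derivative
      (if x = 0 then - 1 else Li 2 (- x / (1 - x)) * (1 / x + 1 / (1 - x)))) (at x)"
    using DERIV_Li_chain(2)[OF du u(1)] unfolding * .
  show "((\<lambda>x. Li 4 (- x / (1 - x))) has_real_derivative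
      (if x = 0 then - 1 else Li 3 (- x / (1 - x)) * (1 / x + 1 / (1 - x)))) (at x)"
    using DERIV_Li_chain(3)[OF du u(1)] unfolding * .
qed

lemma DERIV_Li_234:
  assumes "x < 1"
  shows "(Li 2 has_real_derivative (if x = 0 then 1 else - ln (1 - x) * (1 / x))) (at x)"
    and "(Li 3 has_real_derivative (if x = 0 then 1 else Li 2 x * (1 / x))) (at x)"
    and "(Li 4 has_real_derivative (if x = 0 then 1 else Li 3 x * (1 / x))) (at x)"
  using DERIV_Li_chain[OF DERIV_ident, of x] assms
  by (cases "x = 0"; simp add: Li_quot_def Li_1_eq del: Li.simps One_nat_def)+

lemma DERIV_Li_one_minus:
  assumes "0 < x" "x < 1"
  shows "((\<lambda>x. Li 3 (1 - x)) has_real_derivative - (Li 2 (1 - x) * (1 / (1 - x)))) (at x)"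
    and "((\<lambda>x. Li 4 (1 - x)) has_real_derivative - (Li 3 (1 - x) * (1 / (1 - x)))) (at x)"
proof -
  have "((\<lambda>x. 1 - x) has_real_derivative - 1) (at x)"
    by (auto intro!: derivative_eq_intros)
  from DERIV_Li_chain(2,3)[OF this] assms
  show "((\<lambda>x. Li 3 (1 - x)) has_real_derivative - (Li 2 (1 - x) * (1 / (1 - x)))) (at x)"
    and "((\<lambda>x. Li 4 (1 - x)) has_real_derivative - (Li 3 (1 - x) * (1 / (1 - x)))) (at x)"
    by (simp_all add: Li_quot_def del: Li.simps)
qed

lemma DERIV_ln_one_minus:
  "x < 1 \<Longrightarrow> ((\<lambda>x. ln (1 - x)) has_real_derivative - (1 / (1 - x))) (at x)" for x :: real
  by (auto intro!: derivative_eq_intros simp: field_simps)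

text \<open>Both sides vanish at 0. Away from 0, once Landen's identity has replaced
  \<open>Li 2 (- x / (1 - x))\<close>, the squared logarithms in the derivative of the right side
  cancel and \<open>Li 2 x * (1 / x + 1 / (1 - x))\<close> remains.\<close>

lemma suminf_harm2_div_power:
  assumes "\<bar>x\<bar> < 1"
  shows "(\<Sum>n. harm2 n / real n * x ^ n)
    = - Li 3 x - 2 * Li 3 (- x / (1 - x)) + ln (1 - x) * Li 2 x + (ln (1 - x)) ^ 3 / 3"
proof (rule eq_if_DERIV_eq[where a="-1" and b=1 and y=0 and x=x
      and f="\<lambda>x. \<Sum>n. harm2 n / real n * x ^ n"
      and g="\<lambda>x. - Li 3 x - 2 * Li 3 (- x / (1 - x)) + ln (1 - x) * Li 2 x + (ln (1 - x)) ^ 3 / 3"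
      and h="\<lambda>x. \<Sum>n. harm2 (Suc n) * x ^ n"])
  fix x :: real assume x: "-1 < x" "x < 1"
  show "((\<lambda>x. \<Sum>n. harm2 n / real n * x ^ n) has_real_derivative
      (\<Sum>n. harm2 (Suc n) * x ^ n)) (at x)"
    using x by (intro DERIV_suminf_div_power[OF abs_harm2_le]) auto
  \<comment> \<open>Naming the two reciprocals reduces the comparison of derivatives to a polynomial
    identity with \<open>a\<close> and \<open>b\<close> as independent variables.\<close>
  define a b where "a = 1 / x" and "b = 1 / (1 - x)"
  note D = DERIV_Li_234[OF x(2), folded a_def] DERIV_Li_neg_div_one_minus[OF x(2), folded a_def b_def]
    DERIV_ln_one_minus[OF x(2), folded b_def]
  have "((\<lambda>x. - Li 3 x - 2 * Li 3 (- x / (1 - x)) + ln (1 - x) * Li 2 x + (ln (1 - x)) ^ 3 / 3)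
      has_real_derivative (if x = 0 then 1 else Li 2 x * (a + b))) (at x)"
  proof (cases "x = 0")
    case True
    show ?thesis
      by (rule D DERIV_cdivide derivative_eq_intros refl)+ (simp add: True)
  next
    case False
    show ?thesis
      by (rule D DERIV_cdivide derivative_eq_intros refl)+
        (simp only: Li_2_Landen[OF x(2)], simp add: False field_simps power2_eq_square)
  qed
  moreover have "(if x = 0 then 1 else Li 2 x * (a + b)) = (\<Sum>n. harm2 (Suc n) * x ^ n)"
  proof (cases "x = 0")
    case True
    thus ?thesis using powser_zero[of "\<lambda>n. harm2 (Suc n)"] by (simp add: harm2_Suc)
  next
    case False
    have "x * (1 - x) * (\<Sum>n. harm2 (Suc n) * x ^ n) = Li 2 x"
      using x by (intro suminf_harm2_power) auto
    moreover have "a + b = 1 / (x * (1 - x))"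
      using x False by (simp add: a_def b_def field_simps)
    ultimately show ?thesis using x False by (simp add: nonzero_divide_eq_eq mult_ac)
  qed
  ultimately show "((\<lambda>x. - Li 3 x - 2 * Li 3 (- x / (1 - x)) + ln (1 - x) * Li 2 x + (ln (1 - x)) ^ 3 / 3)
      has_real_derivative (\<Sum>n. harm2 (Suc n) * x ^ n)) (at x)" by simp
qed (use assms powser_zero[of "\<lambda>n. harm2 n / real n"] in auto)

section \<open>The series in question: derivative and convergence\<close>

text \<open>Termwise differentiation removes one factor \<open>n\<close> from the denominator and
  lowers the exponent of \<open>x\<close> by one; multiplying by \<open>x\<close> restores the
  series already evaluated.\<close>

lemma DERIV_suminf_harm2_div_square:
  assumes "\<bar>x\<bar> < 1" "x \<noteq> 0"
  shows "((\<lambda>x. \<Sum>n. harm2 n / (real n)\<^sup>2 * x ^ n) has_real_derivative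
    (- Li 3 x - 2 * Li 3 (- x / (1 - x)) + ln (1 - x) * Li 2 x + (ln (1 - x)) ^ 3 / 3) * (1 / x)) (at x)"
proof -
  have "((\<lambda>x. \<Sum>n. harm2 n / real n / real n * x ^ n) has_real_derivative
      (\<Sum>n. harm2 (Suc n) / real (Suc n) * x ^ n)) (at x)"
    using assms by (intro DERIV_suminf_div_power[OF abs_harm2_div_le])
  moreover have "(\<Sum>n. harm2 n / real n * x ^ n) = x * (\<Sum>n. harm2 (Suc n) / real (Suc n) * x ^ n)"
    using suminf_power_split[OF abs_harm2_div_le assms(1)] by simp
  hence "(\<Sum>n. harm2 (Suc n) / real (Suc n) * x ^ n) =
    (- Li 3 x - 2 * Li 3 (- x / (1 - x)) + ln (1 - x) * Li 2 x + (ln (1 - x)) ^ 3 / 3) * (1 / x)"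
    using assms suminf_harm2_div_power[of x] by (simp add: field_simps)
  ultimately show ?thesis by (simp add: power2_eq_square)
qed

text \<open>The numerators are bounded. Absolute summability of the coefficients gives continuity of
  the sum on the closed interval, which the endpoint of the alternating case relies on.\<close>

lemma summable_harm2_div_square: "summable (\<lambda>n. \<bar>harm2 n / (real n)\<^sup>2\<bar>)"
proof (rule summable_comparison_test)
  show "\<exists>N. \<forall>n\<ge>N. norm \<bar>harm2 n / (real n)\<^sup>2\<bar> \<le> (\<Sum>n. 1 / real n ^ 2) * (1 / (real n)\<^sup>2)"
    using abs_harm2_le by (auto simp: abs_mult divide_right_mono)
  show "summable (\<lambda>n. (\<Sum>n. 1 / real n ^ 2) * (1 / (real n)\<^sup>2))"
    by (intro summable_mult summable_inverse_power) auto
qed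

lemma sums_harm2_div_square:
  assumes "\<bar>x\<bar> \<le> 1"
  shows "(\<lambda>n. harm2 (Suc n) / (real (Suc n))\<^sup>2 * x ^ Suc n) sums
    (\<Sum>n. harm2 n / (real n)\<^sup>2 * x ^ n)"
proof -
  have "summable (\<lambda>n. harm2 n / (real n)\<^sup>2 * x ^ n)"
    by (rule summable_comparison_test[OF _ summable_harm2_div_square])
       (use assms in \<open>auto simp: abs_mult power_abs intro!: divide_right_mono mult_left_le power_le_one\<close>)
  hence "(\<lambda>n. harm2 n / (real n)\<^sup>2 * x ^ n) sums (\<Sum>n. harm2 n / (real n)\<^sup>2 * x ^ n)"
    by (rule summable_sums)
  thus ?thesis by (subst sums_Suc_iff) simp
qed

section \<open>The trilogarithm relation and the sum for positive argument\<close>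

text \<open>Landen's identity and the reflection formula express every dilogarithm in the two
  derivatives through \<open>Li 2 x\<close>, after which they agree. At 0 the constant
  \<open>Li 3 1\<close> cancels the limit of \<open>Li 3 (1 - x)\<close>.\<close>

lemma Li_3_Landen:
  assumes "0 < x" "x < 1"
  shows "Li 3 (- x / (1 - x)) = - Li 3 (1 - x) - Li 3 x + Li 3 1 + (ln (1 - x)) ^ 3 / 6
    + pi\<^sup>2 / 6 * ln (1 - x) - ln x * (ln (1 - x))\<^sup>2 / 2"
proof (rule eq_if_DERIV_eq_at_right[where a=0 and b=1 and l=0 and x=x
      and f="\<lambda>x. Li 3 (- x / (1 - x))"
      and g="\<lambda>x. - Li 3 (1 - x) - Li 3 x + Li 3 1 + (ln (1 - x)) ^ 3 / 6
        + pi\<^sup>2 / 6 * ln (1 - x) - ln x * (ln (1 - x))\<^sup>2 / 2"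
      and h="\<lambda>x. Li 2 (- x / (1 - x)) * (1 / x + 1 / (1 - x))"])
  fix x :: real assume x: "0 < x" "x < 1"
  show "((\<lambda>x. Li 3 (- x / (1 - x))) has_real_derivative Li 2 (- x / (1 - x)) * (1 / x + 1 / (1 - x))) (at x)"
    using DERIV_Li_neg_div_one_minus(1)[OF x(2)] x by simp
  define a b where "a = 1 / x" and "b = 1 / (1 - x)"
  note D = DERIV_Li_one_minus[OF x, folded b_def] DERIV_Li_234[OF x(2), folded a_def] DERIV_ln_one_minus[OF x(2), folded b_def]
    DERIV_ln_divide[OF x(1), folded a_def]
  have "Li 2 (1 - x) = pi\<^sup>2 / 6 - ln x * ln (1 - x) - Li 2 x"
    using Li_2_reflection[OF x] by simp
  note eq = this Li_2_Landen[OF x(2)]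
  show "((\<lambda>x. - Li 3 (1 - x) - Li 3 x + Li 3 1 + (ln (1 - x)) ^ 3 / 6
        + pi\<^sup>2 / 6 * ln (1 - x) - ln x * (ln (1 - x))\<^sup>2 / 2) has_real_derivative
     Li 2 (- x / (1 - x)) * (1 / x + 1 / (1 - x))) (at x)"
    unfolding a_def[symmetric] b_def[symmetric]
    using x
    by - ((rule D DERIV_cdivide derivative_eq_intros refl)+,
        simp only: eq, simp add: field_simps power2_eq_square)
next
  have "((\<lambda>x::real. Li 3 (- x / (1 - x))) \<longlongrightarrow> Li 3 (- 0 / (1 - 0))) (at_right 0)"
    by (intro tendsto_intros) auto
  thus "((\<lambda>x::real. Li 3 (- x / (1 - x))) \<longlongrightarrow> 0) (at_right 0)" by simp
  \<comment> \<open>The only indeterminate product; the remaining terms have limits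
    separately.\<close>
  have "((\<lambda>x::real. ln x * (ln (1 - x))\<^sup>2) \<longlongrightarrow> 0) (at_right 0)" by real_asymp
  hence "((\<lambda>x. - Li 3 (1 - x) - Li 3 x + Li 3 1 + (ln (1 - x)) ^ 3 / 6
        + pi\<^sup>2 / 6 * ln (1 - x) - ln x * (ln (1 - x))\<^sup>2 / 2) \<longlongrightarrow>
      - Li 3 1 - Li 3 0 + Li 3 1 + (ln (1 - 0)) ^ 3 / 6 + pi\<^sup>2 / 6 * ln (1 - 0) - 0 / 2) (at_right 0)"
    by (intro tendsto_intros Li_one_minus_tendsto) auto
  thus "((\<lambda>x. - Li 3 (1 - x) - Li 3 x + Li 3 1 + (ln (1 - x)) ^ 3 / 6
        + pi\<^sup>2 / 6 * ln (1 - x) - ln x * (ln (1 - x))\<^sup>2 / 2) \<longlongrightarrow> 0) (at_right 0)" by simp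
qed (use assms in auto)

lemma suminf_harm2_tendsto_0:
  "((\<lambda>x. \<Sum>n. harm2 n / (real n)\<^sup>2 * x ^ n) \<longlongrightarrow> 0) (at (0::real))"
proof -
  have "isCont (\<lambda>x::real. \<Sum>n. harm2 n / (real n)\<^sup>2 * x ^ n) 0"
    by (rule continuous_on_interior[OF continuous_on_suminf_power[OF summable_harm2_div_square]]) simp
  thus ?thesis
    using powser_zero[of "\<lambda>n. harm2 n / (real n)\<^sup>2"] by (simp add: isCont_def)
qed

lemma suminf_harm2_pos:
  assumes "0 < x" "x < 1"
  shows "(\<Sum>n. harm2 n / (real n)\<^sup>2 * x ^ n) =
              (- Li 4 x - 2 * Li 4 (- x / (1 - x)) + 2 * Li 4 (1 - x) - 2 * Li 4 1
               + 2 * Li 3 x * ln (1 - x) - 2 * Li 3 1 * ln (1 - x)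
               + 1 / 2 * (Li 2 x)\<^sup>2 - 1 / 6 * pi\<^sup>2 * (ln (1 - x))\<^sup>2
               + 1 / 3 * ln x * (ln (1 - x)) ^ 3 - 1 / 12 * (ln (1 - x)) ^ 4)"
proof -
  define F where "F x = (- Li 4 x - 2 * Li 4 (- x / (1 - x)) + 2 * Li 4 (1 - x) - 2 * Li 4 1
               + 2 * Li 3 x * ln (1 - x) - 2 * Li 3 1 * ln (1 - x)
               + 1 / 2 * (Li 2 x)\<^sup>2 - 1 / 6 * pi\<^sup>2 * (ln (1 - x))\<^sup>2
               + 1 / 3 * ln x * (ln (1 - x)) ^ 3 - 1 / 12 * (ln (1 - x)) ^ 4)" for x :: real
  define h where "h x = (- Li 3 x - 2 * Li 3 (- x / (1 - x)) + ln (1 - x) * Li 2 x + (ln (1 - x)) ^ 3 / 3) * (1 / x)"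
    for x :: real
  have "(\<Sum>n. harm2 n / (real n)\<^sup>2 * x ^ n) = F x"
  proof (rule eq_if_DERIV_eq_at_right[where a=0 and b=1 and l=0 and x=x and g=F and h=h
        and f="\<lambda>x. \<Sum>n. harm2 n / (real n)\<^sup>2 * x ^ n"])
    fix x :: real assume x: "0 < x" "x < 1"
    show "((\<lambda>x. \<Sum>n. harm2 n / (real n)\<^sup>2 * x ^ n) has_real_derivative h x) (at x)"
      unfolding h_def using x by (intro DERIV_suminf_harm2_div_square) auto
    define a b where "a = 1 / x" and "b = 1 / (1 - x)"
    note D = DERIV_Li_234[OF x(2), folded a_def] DERIV_Li_one_minus[OF x, folded b_def]
      DERIV_Li_neg_div_one_minus[OF x(2), folded a_def b_def]
      DERIV_ln_one_minus[OF x(2), folded b_def] DERIV_ln_divide[OF x(1), folded a_def]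
    \<comment> \<open>The coefficient of \<open>b\<close> in the derivative of \<open>F\<close> is
      twice the difference of the two sides of \<open>Li_3_Landen\<close>, hence 0; the coefficient
      of \<open>a\<close> is that of \<open>h\<close>.\<close>
    show "(F has_real_derivative h x) (at x)"
      unfolding F_def[abs_def] h_def a_def[symmetric]
      using x
      by - ((rule D DERIV_cdivide derivative_eq_intros refl)+,
          simp only: Li_3_Landen[OF x], simp add: field_simps power2_eq_square power3_eq_cube)
  next
    show "((\<lambda>x. \<Sum>n. harm2 n / (real n)\<^sup>2 * x ^ n) \<longlongrightarrow> 0) (at_right (0::real))"
      by (rule filterlim_mono[OF suminf_harm2_tendsto_0 order_refl at_le]) simp
    have "((\<lambda>x::real. 1 / 3 * ln x * (ln (1 - x)) ^ 3) \<longlongrightarrow> 0) (at_right 0)" by real_asymp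
    hence "(F \<longlongrightarrow> - Li 4 0 - 2 * Li 4 (- 0 / (1 - 0)) + 2 * Li 4 1 - 2 * Li 4 1
               + 2 * Li 3 0 * ln (1 - 0) - 2 * Li 3 1 * ln (1 - 0)
               + 1 / 2 * (Li 2 0)\<^sup>2 - 1 / 6 * pi\<^sup>2 * (ln (1 - 0))\<^sup>2
               + 0 - 1 / 12 * (ln (1 - 0)) ^ 4) (at_right 0)"
      unfolding F_def[abs_def] by (intro tendsto_intros Li_one_minus_tendsto) auto
    thus "(F \<longlongrightarrow> 0) (at_right 0)" by simp
  qed (use assms in auto)
  thus ?thesis by (simp only: F_def)
qed

section \<open>The alternating sum\<close>

lemma DERIV_Li_one_plus:
  assumes "0 < x"
  shows "((\<lambda>x. Li 3 (x / (1 + x))) has_real_derivative Li 2 (x / (1 + x)) * (1 / x - 1 / (1 + x))) (at x)"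
    and "((\<lambda>x. Li 4 (x / (1 + x))) has_real_derivative Li 3 (x / (1 + x)) * (1 / x - 1 / (1 + x))) (at x)"
    and "((\<lambda>x. Li 3 (1 / (1 + x))) has_real_derivative - (Li 2 (1 / (1 + x)) * (1 / (1 + x)))) (at x)"
    and "((\<lambda>x. Li 4 (1 / (1 + x))) has_real_derivative - (Li 3 (1 / (1 + x)) * (1 / (1 + x)))) (at x)"
proof -
  have u: "x / (1 + x) < 1" "x / (1 + x) \<noteq> 0" and w: "1 / (1 + x) < 1" "1 / (1 + x) \<noteq> 0"
    using assms by (auto simp: field_simps)
  \<comment> \<open>The derivative is written as the function times its logarithmic derivative, so
    that the first factor cancels the denominator in \<open>Li_quot\<close>; the same form is used
    in \<open>dw\<close>.\<close>
  have du: "((\<lambda>x. x / (1 + x)) has_real_derivative x / (1 + x) * (1 / x - 1 / (1 + x))) (at x)"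
    using assms by (auto intro!: derivative_eq_intros simp: divide_simps)
  have dw: "((\<lambda>x. 1 / (1 + x)) has_real_derivative - (1 / (1 + x) * (1 / (1 + x)))) (at x)"
    using assms by (auto intro!: derivative_eq_intros simp: divide_simps)
  have *: "Li_quot p y * (y * c) = Li p y * c" "Li_quot p y * (- (y * c)) = - (Li p y * c)"
    if "y \<noteq> 0" for p y c using that by (simp_all add: Li_quot_def)
  show "((\<lambda>x. Li 3 (x / (1 + x))) has_real_derivative Li 2 (x / (1 + x)) * (1 / x - 1 / (1 + x))) (at x)"
    and "((\<lambda>x. Li 4 (x / (1 + x))) has_real_derivative Li 3 (x / (1 + x)) * (1 / x - 1 / (1 + x))) (at x)"
    using DERIV_Li_chain(2,3)[OF du u(1)] unfolding *[OF u(2)] .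
  show "((\<lambda>x. Li 3 (1 / (1 + x))) has_real_derivative - (Li 2 (1 / (1 + x)) * (1 / (1 + x)))) (at x)"
    and "((\<lambda>x. Li 4 (1 / (1 + x))) has_real_derivative - (Li 3 (1 / (1 + x)) * (1 / (1 + x)))) (at x)"
    using DERIV_Li_chain(2,3)[OF dw w(1)] unfolding *[OF w(2)] .
qed

lemma DERIV_Li_uminus:
  assumes "0 < x"
  shows "((\<lambda>x. Li 2 (- x)) has_real_derivative - ln (1 + x) * (1 / x)) (at x)"
    and "((\<lambda>x. Li 4 (- x)) has_real_derivative Li 3 (- x) * (1 / x)) (at x)"
  using DERIV_Li_chain[OF DERIV_minus[OF DERIV_ident], of x] assms
  by (simp_all add: Li_quot_def Li_1_eq del: Li.simps One_nat_def)

text \<open>Among the terms with \<open>1 / (1 + x)\<close> the trilogarithms cancel in pairs and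
  the rest cancels by reflection at \<open>x / (1 + x)\<close>, whose complement is
  \<open>1 / (1 + x)\<close>. Landen's identity at \<open>- x\<close> settles the terms with
  \<open>1 / x\<close>. The range includes \<open>x = 1\<close>, where the result provides
  continuity.\<close>

lemma DERIV_harm2_closed_form_neg:
  assumes x: "0 < x"
  shows "((\<lambda>x. - Li 4 (- x) - 2 * Li 4 (x / (1 + x)) - 2 * Li 4 (1 / (1 + x)) + 2 * Li 4 1
               - 2 * Li 3 (x / (1 + x)) * ln (1 + x) - 2 * Li 3 (1 / (1 + x)) * ln (1 + x)
               + 1 / 2 * (Li 2 (- x))\<^sup>2 - 1 / 6 * pi\<^sup>2 * (ln (1 + x))\<^sup>2
               - 2 / 3 * ln x * (ln (1 + x)) ^ 3 + 1 / 2 * (ln (1 + x)) ^ 4) has_real_derivative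
    (- Li 3 (- x) - 2 * Li 3 (x / (1 + x)) + ln (1 + x) * Li 2 (- x) + (ln (1 + x)) ^ 3 / 3) * (1 / x)) (at x)"
proof -
  define a b where "a = 1 / x" and "b = 1 / (1 + x)"
  have "((\<lambda>x. ln (1 + x)) has_real_derivative b) (at x)"
    using x by (auto intro!: derivative_eq_intros simp: b_def)
  note D = this DERIV_Li_uminus[OF x, folded a_def] DERIV_Li_one_plus[OF x, folded a_def b_def]
    DERIV_ln_divide[OF x, folded a_def]
  have u: "Li 2 (x / (1 + x)) = - Li 2 (- x) - (ln (1 + x))\<^sup>2 / 2"
    using Li_2_Landen[of "- x"] x by simp
  have "1 - x / (1 + x) = 1 / (1 + x)" "ln (x / (1 + x)) = ln x - ln (1 + x)"
    "ln (1 / (1 + x)) = - ln (1 + x)"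
    using x by (simp_all add: field_simps ln_div)
  hence "Li 2 (1 / (1 + x)) = pi\<^sup>2 / 6 - (ln x - ln (1 + x)) * (- ln (1 + x)) - Li 2 (x / (1 + x))"
    using Li_2_reflection[of "x / (1 + x)"] x by simp
  note w = this[unfolded u, folded b_def]
  show ?thesis
    unfolding a_def[symmetric]
    by ((rule D DERIV_cdivide derivative_eq_intros refl)+,
        simp only: u w b_def[symmetric], simp add: field_simps power2_eq_square power3_eq_cube)
qed

lemma suminf_harm2_neg:
  assumes "0 < x" "x \<le> 1"
  shows "(\<Sum>n. harm2 n / (real n)\<^sup>2 * (- x) ^ n) =
              (- Li 4 (- x) - 2 * Li 4 (x / (1 + x)) - 2 * Li 4 (1 / (1 + x)) + 2 * Li 4 1
               - 2 * Li 3 (x / (1 + x)) * ln (1 + x) - 2 * Li 3 (1 / (1 + x)) * ln (1 + x)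
               + 1 / 2 * (Li 2 (- x))\<^sup>2 - 1 / 6 * pi\<^sup>2 * (ln (1 + x))\<^sup>2
               - 2 / 3 * ln x * (ln (1 + x)) ^ 3 + 1 / 2 * (ln (1 + x)) ^ 4)"
proof -
  define S where "S x = (\<Sum>n. harm2 n / (real n)\<^sup>2 * (- x) ^ n)" for x :: real
  define G where "G x = (- Li 4 (- x) - 2 * Li 4 (x / (1 + x)) - 2 * Li 4 (1 / (1 + x)) + 2 * Li 4 1
               - 2 * Li 3 (x / (1 + x)) * ln (1 + x) - 2 * Li 3 (1 / (1 + x)) * ln (1 + x)
               + 1 / 2 * (Li 2 (- x))\<^sup>2 - 1 / 6 * pi\<^sup>2 * (ln (1 + x))\<^sup>2
               - 2 / 3 * ln x * (ln (1 + x)) ^ 3 + 1 / 2 * (ln (1 + x)) ^ 4)" for x :: real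
  define h where "h x = (- Li 3 (- x) - 2 * Li 3 (x / (1 + x)) + ln (1 + x) * Li 2 (- x) + (ln (1 + x)) ^ 3 / 3) * (1 / x)"
    for x :: real
  have G: "(G has_real_derivative h x) (at x)" if "0 < x" for x
    unfolding G_def[abs_def] h_def using that by (rule DERIV_harm2_closed_form_neg)
  have eq: "S x = G x" if "0 < x" "x < 1" for x
  proof (rule eq_if_DERIV_eq_at_right[where a=0 and b=1 and l=0 and x=x and f=S and g=G and h=h])
    fix x :: real assume x: "0 < x" "x < 1"
    \<comment> \<open>At \<open>y = - x\<close> the argument \<open>- y / (1 - y)\<close> becomes
      \<open>x / (1 + x)\<close>, while the factor \<open>1 / y = - 1 / x\<close> causes the sign of
      \<open>- h x\<close>.\<close>
    have "((\<lambda>y. \<Sum>n. harm2 n / (real n)\<^sup>2 * y ^ n) has_real_derivative - h x) (at (- x))"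
      using DERIV_suminf_harm2_div_square[of "- x"] x by (simp add: h_def)
    from DERIV_chain2[OF this DERIV_minus[OF DERIV_ident]]
    show "(S has_real_derivative h x) (at x)" by (simp add: S_def[abs_def])
    show "(G has_real_derivative h x) (at x)" using x by (intro G)
  next
    have "filterlim uminus (at (0::real)) (at_right 0)" by real_asymp
    from filterlim_compose[OF suminf_harm2_tendsto_0 this]
    show "(S \<longlongrightarrow> 0) (at_right 0)" by (simp add: S_def[abs_def])
    have "((\<lambda>x::real. 2 / 3 * ln x * (ln (1 + x)) ^ 3) \<longlongrightarrow> 0) (at_right 0)" by real_asymp
    moreover have "filterlim (\<lambda>x::real. 1 / (1 + x)) (at_left 1) (at_right 0)" by real_asymp
    ultimately have "(G \<longlongrightarrow> - Li 4 (- 0) - 2 * Li 4 (0 / (1 + 0)) - 2 * Li 4 1 + 2 * Li 4 1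
               - 2 * Li 3 (0 / (1 + 0)) * ln (1 + 0) - 2 * Li 3 1 * ln (1 + 0)
               + 1 / 2 * (Li 2 (- 0))\<^sup>2 - 1 / 6 * pi\<^sup>2 * (ln (1 + 0))\<^sup>2
               - 0 + 1 / 2 * (ln (1 + 0)) ^ 4) (at_right 0)"
      unfolding G_def[abs_def] by (intro tendsto_intros Li_tendsto_Li_1) auto
    thus "(G \<longlongrightarrow> 0) (at_right 0)" by simp
  qed (use that in auto)
  have "S x = G x"
  proof (cases "x = 1")
    case True
    \<comment> \<open>The derivative of the series is known only inside the unit interval, so at 1
      the left-hand limits are compared: \<open>S\<close> is continuous up to the boundary,
      \<open>G\<close> is differentiable there, and they agree on the left.\<close>
    have "continuous_on {0..1} S"
      unfolding S_def[abs_def]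
      by (intro continuous_on_compose2[OF continuous_on_suminf_power[OF summable_harm2_div_square]]
            continuous_intros) auto
    from bspec[OF this[unfolded continuous_on_def], of 1]
    have "(S \<longlongrightarrow> S 1) (at_left 1)" by (simp add: at_within_Icc_at_left)
    hence "(G \<longlongrightarrow> S 1) (at_left 1)"
      by (rule Lim_transform_eventually) (auto intro!: eventually_at_leftI[of 0] eq)
    moreover have "(G \<longlongrightarrow> G 1) (at_left 1)"
      using DERIV_isCont[OF G[of 1]] by (simp add: isCont_def filterlim_at_split)
    ultimately have "S 1 = G 1" by (intro tendsto_unique[of "at_left 1"]) simp_all
    thus ?thesis by (simp add: True)
  qed (use assms eq in auto)
  thus ?thesis by (simp only: S_def G_def)
qed

theorem theorem4:
  shows "(\<forall>x::real. 0 < x \<and> x < 1 \<longrightarrow>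
            (\<lambda>n. harm2 (Suc n) / (real (Suc n))\<^sup>2 * x ^ Suc n) sums
              (- Li 4 x - 2 * Li 4 (- x / (1 - x)) + 2 * Li 4 (1 - x) - 2 * Li 4 1
               + 2 * Li 3 x * ln (1 - x) - 2 * Li 3 1 * ln (1 - x)
               + 1 / 2 * (Li 2 x)\<^sup>2 - 1 / 6 * pi\<^sup>2 * (ln (1 - x))\<^sup>2
               + 1 / 3 * ln x * (ln (1 - x)) ^ 3 - 1 / 12 * (ln (1 - x)) ^ 4)) \<and>
         (\<forall>x::real. 0 < x \<and> x \<le> 1 \<longrightarrow>
            (\<lambda>n. harm2 (Suc n) / (real (Suc n))\<^sup>2 * (- x) ^ Suc n) sums
              (- Li 4 (- x) - 2 * Li 4 (x / (1 + x)) - 2 * Li 4 (1 / (1 + x)) + 2 * Li 4 1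
               - 2 * Li 3 (x / (1 + x)) * ln (1 + x) - 2 * Li 3 (1 / (1 + x)) * ln (1 + x)
               + 1 / 2 * (Li 2 (- x))\<^sup>2 - 1 / 6 * pi\<^sup>2 * (ln (1 + x))\<^sup>2
               - 2 / 3 * ln x * (ln (1 + x)) ^ 3 + 1 / 2 * (ln (1 + x)) ^ 4))"
proof (intro conjI allI impI; elim conjE)
  fix x :: real
  assume "0 < x" "x < 1"
  thus "(\<lambda>n. harm2 (Suc n) / (real (Suc n))\<^sup>2 * x ^ Suc n) sums
              (- Li 4 x - 2 * Li 4 (- x / (1 - x)) + 2 * Li 4 (1 - x) - 2 * Li 4 1
               + 2 * Li 3 x * ln (1 - x) - 2 * Li 3 1 * ln (1 - x)
               + 1 / 2 * (Li 2 x)\<^sup>2 - 1 / 6 * pi\<^sup>2 * (ln (1 - x))\<^sup>2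
               + 1 / 3 * ln x * (ln (1 - x)) ^ 3 - 1 / 12 * (ln (1 - x)) ^ 4)"
    using sums_harm2_div_square[of x] unfolding suminf_harm2_pos[OF \<open>0 < x\<close> \<open>x < 1\<close>] by simp
next
  fix x :: real
  assume "0 < x" "x \<le> 1"
  thus "(\<lambda>n. harm2 (Suc n) / (real (Suc n))\<^sup>2 * (- x) ^ Suc n) sums
              (- Li 4 (- x) - 2 * Li 4 (x / (1 + x)) - 2 * Li 4 (1 / (1 + x)) + 2 * Li 4 1
               - 2 * Li 3 (x / (1 + x)) * ln (1 + x) - 2 * Li 3 (1 / (1 + x)) * ln (1 + x)
               + 1 / 2 * (Li 2 (- x))\<^sup>2 - 1 / 6 * pi\<^sup>2 * (ln (1 + x))\<^sup>2
               - 2 / 3 * ln x * (ln (1 + x)) ^ 3 + 1 / 2 * (ln (1 + x)) ^ 4)"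
    using sums_harm2_div_square[of "- x"] unfolding suminf_harm2_neg[OF \<open>0 < x\<close> \<open>x \<le> 1\<close>] by simp
qed

end
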